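(* Assume that the difference equation $u_{n+1}=A_nu_n$, $n\in\mathbb{N}_0$, has the dichotomy spectrum $\Sigma_{\mathrm{ED}}=\bigcup_{i=1}^{\ell}[\sigma_i^-,\sigma_i^+]$ with fibers $\mathcal{W}_k^i$, $i=1,\ldots,\ell$, $k\in\mathbb{N}_0$. Further assume that the inner and the uniform inner angular values agree within each fiber, i.e. for $i=1,\ldots,\ell$ the following holds: $$\overline{\theta}_1(\mathcal{W}_0^i)=\lim_{n\to\infty}\frac1n\sup_{v\in\mathcal{W}_0^i,\,v\ne0}\ \sup_{k\in\mathbb{N}_0}a_{k+1,k+n}(v).$$ Then the first (upper) inner angular value $\overline{\theta}_1=\overline{\theta}_1(\mathbb{R}^d)$ satisfies $$\overline{\theta}_1=\max_{i=1,\ldots,\ell}\overline{\theta}_1(\mathcal{W}_0^i).$$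
   Context: Setting: $A_n\in\mathbb{R}^{d,d}$, $n\in\mathbb{N}_0$, are invertible, and $\|A_n\|$, $\|A_n^{-1}\|$ are uniformly bounded in $n$. The solution operator is $\Phi(n,m)=A_{n-1}\cdots A_m$ for $n>m$, $\Phi(n,n)=I$, $\Phi(n,m)=A_n^{-1}\cdots A_{m-1}^{-1}$ for $n<m$. $\|\cdot\|$ is the Euclidean norm of vectors and the associated spectral norm; $\mathcal{R}(P)$ is the range of $P$. For nonzero $v,w\in\mathbb{R}^d$, $\angle(v,w)\in[0,\frac\pi2]$ is the principal angle between the lines $\mathrm{span}(v)$ and $\mathrm{span}(w)$, i.e. $\cos\angle(v,w)=|v^\top w|/(\|v\|\|w\|)$. For $v\ne0$ and $m,n\in\mathbb{N}$ set $$a_{m,n}(v)=\sum_{j=m}^{n}\angle(\Phi(j-1,0)v,\Phi(j,0)v),\qquad a_{m,n}(v)=0\text{ for } m>n.$$ For a subspace $V\subseteq\mathbb{R}^d$ set $\overline{\theta}_1(V)=\limsup_{n\to\infty}\sup_{v\in V,\,v\ne0}\frac{a_{1,n}(v)}{n}$. For $V=\mathbb{R}^d$ this is the (upper) first inner angular value of the system. Exponential dichotomy (ED) on $\mathbb{N}_0$ of a system with solution operator $\Psi$: there are constants $K>0$, $\alpha_s,\alpha_u\in(0,1)$ and projectors $P_n^s$, $P_n^u=I-P_n^s$ ($n\in\mathbb{N}_0$) with $P_n^{s,u}\Psi(n,m)=\Psi(n,m)P_m^{s,u}$ for all $n,m$, and $\|\Psi(n,m)P_m^s\|\le K\alpha_s^{n-m}$,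 $\|\Psi(m,n)P_n^u\|\le K\alpha_u^{n-m}$ for all $n\ge m$. Dichotomy spectrum: $\Sigma_{\mathrm{ED}}=\{\gamma>0: u_{n+1}=\frac1\gamma A_nu_n \text{ has no ED on }\mathbb{N}_0\}$. It is a union of $\ell\le d$ disjoint intervals $[\sigma_i^-,\sigma_i^+]$, $i=1,\ldots,\ell$, with $0<\sigma_\ell^-\le\sigma_\ell^+<\cdots<\sigma_1^-\le\sigma_1^+$. Resolvent intervals: $R_1=(\sigma_1^+,\infty)$, $R_i=(\sigma_i^+,\sigma_{i-1}^-)$ for $i=2,\ldots,\ell+1$, with $\sigma_{\ell+1}^+=0$. Dichotomy projectors: for each $i=1,\ldots,\ell+1$, the scaled systems with $\gamma\in R_i$ have an ED with projectors $P_{n,i}^s$, $P_{n,i}^u=I-P_{n,i}^s$ ($n\in\mathbb{N}_0$) not depending on the choice of $\gamma\in R_i$, which satisfy $P_{n,i}^{s,u}\Phi(n,m)=\Phi(n,m)P_{m,i}^{s,u}$ and, with a constant $K>0$, for all $n\ge m$: $\|\Phi(n,m)P_{m,i}^s\|\le K(\sigma_i^+)^{n-m}$ for $i=1,\ldots,\ell$, and $\|\Phi(m,n)P_{n,i}^u\|\le K(\sigma_{i-1}^-)^{m-n}$ for $i=2,\ldots,\ell+1$. Their ranges form flags: for every $n$, $\{0\}=\mathcal{R}(P_{n,\ell+1}^s)\subseteq\mathcal{R}(P_{n,\ell}^s)\subseteq\cdots\subseteq\mathcal{R}(P_{n,1}^s)=\mathbb{R}^d$ and $\mathbb{R}^d=\mathcal{R}(P_{n,\ell+1}^u)\supseteq\mathcal{R}(P_{n,\ell}^u)\supseteq\cdots\supseteq\mathcal{R}(P_{n,1}^u)=\{0\}$.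 Spectral fibers: $\mathcal{W}_n^i=\mathcal{R}(P_{n,i}^s)\cap\mathcal{R}(P_{n,i+1}^u)$, $i=1,\ldots,\ell$. *)

theory Defs
  imports "HOL-Analysis.Analysis"
begin

text \<open>The library norm on matrices is the Frobenius norm; the spectral norm is the operator norm.\<close>

definition spectral_norm :: "real^'d^'d \<Rightarrow> real" where
  "spectral_norm M = onorm (\<lambda>x. M *v x)"

definition mrange :: "real^'d^'d \<Rightarrow> (real^'d) set" where
  "mrange M = range (\<lambda>x. M *v x)"

text \<open>Since \<open>rev [m..<n] = [n-1,\<dots>,m]\<close>, the two branches are
  \<open>A (n-1) ** \<dots> ** A m\<close> and \<open>matrix_inv (A n) ** \<dots> ** matrix_inv (A (m-1))\<close>.\<close>

definition solution_op :: "(nat \<Rightarrow> real^'d^'d) \<Rightarrow> nat \<Rightarrow> nat \<Rightarrow> real^'d^'d" where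
  "solution_op A n m =
     (if m \<le> n then foldr (\<lambda>j M. A j ** M) (rev [m..<n]) (mat 1)
      else foldr (\<lambda>j M. matrix_inv (A j) ** M) [n..<m] (mat 1))"

definition line_angle :: "real^'d \<Rightarrow> real^'d \<Rightarrow> real" where
  "line_angle v w = arccos (\<bar>v \<bullet> w\<bar> / (norm v * norm w))"

text \<open>Only used for \<open>m \<ge> 1\<close>, so that \<open>j - 1\<close> does not truncate.\<close>

definition angle_sum :: "(nat \<Rightarrow> real^'d^'d) \<Rightarrow> nat \<Rightarrow> nat \<Rightarrow> real^'d \<Rightarrow> real" where
  "angle_sum A m n v =
     (\<Sum>j=m..n. line_angle (solution_op A (j-1) 0 *v v) (solution_op A j 0 *v v))"

text \<open>Suprema and limits superior are taken in the extended reals, where they always exist. For a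
  nonzero subspace the value lies in \<open>[0, pi/2]\<close>; for the zero subspace it is \<open>-\<infinity>\<close>.\<close>

definition inner_angular_value :: "(nat \<Rightarrow> real^'d^'d) \<Rightarrow> (real^'d) set \<Rightarrow> ereal" where
  "inner_angular_value A V =
     limsup (\<lambda>n. SUP v\<in>V - {0}. ereal (angle_sum A 1 n v / real n))"

definition ED_with ::
  "(nat \<Rightarrow> nat \<Rightarrow> real^'d^'d) \<Rightarrow> (nat \<Rightarrow> real^'d^'d) \<Rightarrow> bool" where
  "ED_with \<Psi> P \<longleftrightarrow>
     (\<forall>n. P n ** P n = P n) \<and>
     (\<forall>n m. P n ** \<Psi> n m = \<Psi> n m ** P m) \<and>
     (\<forall>n m. (mat 1 - P n) ** \<Psi> n m = \<Psi> n m ** (mat 1 - P m)) \<and>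
     (\<exists>K \<alpha>s \<alpha>u. 0 < K \<and> 0 < \<alpha>s \<and> \<alpha>s < 1 \<and> 0 < \<alpha>u \<and> \<alpha>u < 1 \<and>
        (\<forall>m n. m \<le> n \<longrightarrow>
           spectral_norm (\<Psi> n m ** P m) \<le> K * \<alpha>s ^ (n - m) \<and>
           spectral_norm (\<Psi> m n ** (mat 1 - P n)) \<le> K * \<alpha>u ^ (n - m)))"

definition has_ED :: "(nat \<Rightarrow> nat \<Rightarrow> real^'d^'d) \<Rightarrow> bool" where
  "has_ED \<Psi> \<longleftrightarrow> (\<exists>P. ED_with \<Psi> P)"

definition scaled_system :: "real \<Rightarrow> (nat \<Rightarrow> real^'d^'d) \<Rightarrow> nat \<Rightarrow> real^'d^'d" where
  "scaled_system \<gamma> A n = (1 / \<gamma>) *\<^sub>R A n"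

definition dichotomy_spectrum :: "(nat \<Rightarrow> real^'d^'d) \<Rightarrow> real set" where
  "dichotomy_spectrum A = {\<gamma>. 0 < \<gamma> \<and> \<not> has_ED (solution_op (scaled_system \<gamma> A))}"

text \<open>The spectral intervals \<open>[\<sigma>m i, \<sigma>p i]\<close>, \<open>i = 1, \<dots>, l\<close>, are numbered from right to left.\<close>

definition spectral_intervals ::
  "(nat \<Rightarrow> real^'d^'d) \<Rightarrow> nat \<Rightarrow> (nat \<Rightarrow> real) \<Rightarrow> (nat \<Rightarrow> real) \<Rightarrow> bool" where
  "spectral_intervals A l \<sigma>m \<sigma>p \<longleftrightarrow>
     1 \<le> l \<and> l \<le> CARD('d) \<and>
     (\<forall>i\<in>{1..l}. 0 < \<sigma>m i \<and> \<sigma>m i \<le> \<sigma>p i) \<and>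
     (\<forall>i\<in>{1..<l}. \<sigma>p (i + 1) < \<sigma>m i) \<and>
     dichotomy_spectrum A = (\<Union>i\<in>{1..l}. {\<sigma>m i..\<sigma>p i})"

text \<open>The conventions \<open>\<sigma>p (l+1) = 0\<close> and \<open>\<sigma>m 0 = \<infinity>\<close> are built in; the actual values of
  \<open>\<sigma>p\<close> and \<open>\<sigma>m\<close> at these indices are irrelevant.\<close>

definition resolvent_interval ::
  "nat \<Rightarrow> (nat \<Rightarrow> real) \<Rightarrow> (nat \<Rightarrow> real) \<Rightarrow> nat \<Rightarrow> real set" where
  "resolvent_interval l \<sigma>m \<sigma>p i =
     {\<gamma>. (if i = l + 1 then 0 else \<sigma>p i) < \<gamma> \<and> (2 \<le> i \<longrightarrow> \<gamma> < \<sigma>m (i - 1))}"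

text \<open>\<open>P n i\<close> is the stable projector at time \<open>n\<close> belonging to the \<open>i\<close>-th resolvent interval.
  On the half line the kernels of the projectors are not determined by the dichotomy, so the
  flag conditions on the unstable ranges restrict the choice of the projectors. No growth bound
  with a rate exactly at an end point of a spectral interval is required (such a bound fails for
  a Jordan block); the dichotomies give bounds for every rate inside the resolvent interval.\<close>

definition dichotomy_projectors ::
  "(nat \<Rightarrow> real^'d^'d) \<Rightarrow> nat \<Rightarrow> (nat \<Rightarrow> real) \<Rightarrow> (nat \<Rightarrow> real)
     \<Rightarrow> (nat \<Rightarrow> nat \<Rightarrow> real^'d^'d) \<Rightarrow> bool" where
  "dichotomy_projectors A l \<sigma>m \<sigma>p P \<longleftrightarrow>
     (\<forall>i\<in>{1..l+1}. \<forall>\<gamma>\<in>resolvent_interval l \<sigma>m \<sigma>p i.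
        ED_with (solution_op (scaled_system \<gamma> A)) (\<lambda>n. P n i)) \<and>
     (\<forall>n. mrange (P n (l+1)) = {0} \<and> mrange (P n 1) = UNIV \<and>
        (\<forall>i\<in>{1..l}. mrange (P n (i+1)) \<subseteq> mrange (P n i))) \<and>
     (\<forall>n. mrange (mat 1 - P n (l+1)) = UNIV \<and> mrange (mat 1 - P n 1) = {0} \<and>
        (\<forall>i\<in>{1..l}. mrange (mat 1 - P n i) \<subseteq> mrange (mat 1 - P n (i+1))))"

definition spectral_fiber ::
  "(nat \<Rightarrow> nat \<Rightarrow> real^'d^'d) \<Rightarrow> nat \<Rightarrow> nat \<Rightarrow> (real^'d) set" where
  "spectral_fiber P n i = mrange (P n i) \<inter> mrange (mat 1 - P n (i+1))"

end

theory Submission imports Defs begin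

text \<open>
  Write \<open>v = w + z\<close> with \<open>w\<close> in the fiber \<open>W_0^i\<close> and \<open>z\<close> in the range of \<open>P_(0,i+1)^s\<close>.
  The dichotomy in the resolvent interval below the fiber makes the ratio of the norms of the
  trajectories of \<open>z\<close> and \<open>w\<close> decay exponentially. So the trajectory of \<open>v\<close> follows that of \<open>z\<close>
  until \<open>w\<close> is no longer negligible, and after a transition of uniformly bounded length it
  follows that of \<open>w\<close>. Hence uniform linear bounds on angle sums, valid for all starting times,
  pass from the fibers to the ranges of the projectors by downward induction on \<open>i\<close>.
\<close>

section \<open>Perturbation of line angles\<close>

text \<open>Split \<open>norm x *\<^sub>R (sgn u - sgn x)\<close> into
  \<open>(norm x - norm u) *\<^sub>R sgn u\<close> and \<open>u - x\<close>; each has norm at most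
  \<open>norm (u - x)\<close>. The factor \<open>norm x\<close> replaces a division, so zero vectors
  are covered.\<close>

lemma norm_sgn_diff_le:
  fixes x u :: "'a::real_inner"
  shows "norm x * norm (sgn u - sgn x) \<le> 2 * norm (u - x)"
proof -
  have n: "norm x *\<^sub>R sgn x = x" "norm u *\<^sub>R sgn u = u"
    by (cases "x = 0"; simp add: sgn_div_norm) (cases "u = 0"; simp add: sgn_div_norm)
  have "norm x * norm (sgn u - sgn x) = norm (norm x *\<^sub>R (sgn u - sgn x))" by simp
  also have "norm x *\<^sub>R (sgn u - sgn x) = (norm x - norm u) *\<^sub>R sgn u + (u - x)"
    by (simp add: scaleR_diff_right scaleR_diff_left n)
  also have "norm \<dots> \<le> \<bar>norm x - norm u\<bar> * norm (sgn u) + norm (u - x)"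
    by (metis norm_scaleR norm_triangle_ineq)
  also have "\<dots> \<le> norm (u - x) * 1 + norm (u - x)"
    using norm_triangle_ineq3[of x u]
    by (intro add_mono mult_mono) (auto simp: norm_sgn norm_minus_commute)
  finally show ?thesis by simp
qed

text \<open>Since \<open>sgn 0 = 0\<close> and division by zero gives zero, this also holds for zero
  vectors, whose angle is \<open>arccos 0\<close>. Later bounds thus carry no side condition on
  perturbed vectors.\<close>

lemma line_angle_sgn: "line_angle v w = arccos \<bar>sgn v \<bullet> sgn w\<bar>"
  by (simp add: line_angle_def sgn_div_norm abs_mult divide_simps mult.commute)

lemma abs_inner_sgn_le_1: "\<bar>sgn v \<bullet> sgn w\<bar> \<le> 1"
  using Cauchy_Schwarz_ineq2[of "sgn v" "sgn w"] by (auto simp: norm_sgn split: if_splits)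

lemma line_angle_le: "line_angle v w \<le> pi / 2"
  unfolding line_angle_sgn
  using arccos_le_arccos[of 0 "\<bar>sgn v \<bullet> sgn w\<bar>"] abs_inner_sgn_le_1[of v w] by simp

text \<open>A relative error \<open>d\<close> moves each unit vector by at most
  \<open>2 * d\<close>, and \<open>arccos\<close> is uniformly continuous on the compact interval
  from -1 to 1. It is not Lipschitz at 1, so \<open>d\<close> comes from \<open>e\<close> by
  compactness.\<close>

lemma line_angle_perturb:
  fixes e :: real
  assumes "e > 0"
  obtains d where "d > 0"
    "\<And>x y a b :: real^'d. \<lbrakk>x \<noteq> 0; y \<noteq> 0; norm a \<le> d * norm x; norm b \<le> d * norm y\<rbrakk>
      \<Longrightarrow> line_angle (x + a) (y + b) \<le> line_angle x y + e"
proof -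
  have "uniformly_continuous_on {-1..1::real} arccos"
    by (intro compact_uniformly_continuous continuous_on_arccos') auto
  then obtain r where r: "r > 0"
    "\<And>s t. \<lbrakk>s \<in> {-1..1}; t \<in> {-1..1}; dist t s < r\<rbrakk> \<Longrightarrow> dist (arccos t) (arccos s) < e"
    using assms unfolding uniformly_continuous_on_def by metis
  \<comment> \<open>With \<open>r / 8\<close> each normalized vector moves by at most
    \<open>r / 4\<close>, hence the inner product by at most \<open>r / 2 < r\<close>.\<close>
  show ?thesis
  proof (rule that[of "r / 8"])
    show "r / 8 > 0" using r by simp
  next
    fix x y a b :: "real^'d"
    assume h: "x \<noteq> 0" "y \<noteq> 0" "norm a \<le> r/8 * norm x" "norm b \<le> r/8 * norm y"
    have sg: "norm (sgn (u + c) - sgn u) \<le> r / 4" if "u \<noteq> 0" "norm c \<le> r/8 * norm u"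
      for u c :: "real^'d"
    proof -
      have "norm u * norm (sgn (u + c) - sgn u) \<le> 2 * norm c"
        using norm_sgn_diff_le[of u "u + c"] by simp
      also have "\<dots> \<le> norm u * (r / 4)" using that by (simp add: mult.commute)
      finally show ?thesis using that by simp
    qed
    define X Y X' Y' where "X = sgn x" "Y = sgn y" "X' = sgn (x + a)" "Y' = sgn (y + b)"
    note d = this
    have "\<bar>X' \<bullet> Y' - X \<bullet> Y\<bar> = \<bar>(X' - X) \<bullet> Y' + X \<bullet> (Y' - Y)\<bar>"
      by (simp add: inner_diff_left inner_diff_right)
    also have "\<dots> \<le> norm (X' - X) * norm Y' + norm X * norm (Y' - Y)"
      using Cauchy_Schwarz_ineq2[of "X' - X" Y'] Cauchy_Schwarz_ineq2[of X "Y' - Y"] by linarith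
    also have "\<dots> \<le> r/4 * 1 + 1 * (r/4)"
      using sg[OF h(1,3)] sg[OF h(2,4)] r(1)
      by (intro add_mono mult_mono) (auto simp: d norm_sgn)
    finally have "dist \<bar>X' \<bullet> Y'\<bar> \<bar>X \<bullet> Y\<bar> < r"
      using r(1) unfolding dist_real_def by linarith
    then have "dist (arccos \<bar>X' \<bullet> Y'\<bar>) (arccos \<bar>X \<bullet> Y\<bar>) < e"
      using abs_inner_sgn_le_1 by (intro r(2)) (auto simp: d intro: order_trans[of _ 0])
    then show "line_angle (x + a) (y + b) \<le> line_angle x y + e"
      unfolding line_angle_sgn d dist_real_def by linarith
  qed
qed

section \<open>Solution operators and dichotomies\<close>

lemma foldr_matrix_mult:
  "foldr (\<lambda>j M. B j ** M) xs (N :: real^'d^'d) = foldr (\<lambda>j M. B j ** M) xs (mat 1) ** N"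
  by (induction xs) (simp_all add: matrix_mul_assoc)

lemma matrix_inv_inverse:
  fixes M :: "real^'d^'d"
  assumes "invertible M"
  shows "M ** matrix_inv M = mat 1" and "matrix_inv M ** M = mat 1"
  using someI_ex[OF assms[unfolded invertible_def]] by (simp_all add: matrix_inv_def)

lemma solution_op_refl [simp]: "solution_op A n n = mat 1"
  by (simp add: solution_op_def)

lemma solution_op_Suc: "m \<le> n \<Longrightarrow> solution_op A (Suc n) m = A n ** solution_op A n m"
  by (simp add: solution_op_def)

text \<open>The new factor enters at the right end of the product, that is, as the start value of
  the fold. The case \<open>m = n\<close> is separate because \<open>solution_op A m n\<close> then
  falls into the forward branch.\<close>

lemma solution_op_Suc_right:
  assumes "m \<le> n"
  shows "solution_op A m (Suc n) = solution_op A m n ** matrix_inv (A n)"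
proof (cases "m = n")
  case False
  then show ?thesis using assms
    by (simp add: solution_op_def) (subst foldr_matrix_mult, simp)
qed (simp add: solution_op_def)

lemma solution_op_cocycle:
  assumes "m \<le> n"
  shows "solution_op A n m ** solution_op A m 0 = solution_op A n 0"
  using assms
  by (induction n rule: dec_induct) (simp_all add: solution_op_Suc matrix_mul_assoc[symmetric])

lemma solution_op_inverse:
  assumes "\<And>n. invertible (A n)" and "m \<le> n"
  shows "solution_op A m n ** solution_op A n m = mat 1"
  using assms(2)
proof (induction n rule: dec_induct)
  case (step n)
  have "solution_op A m (Suc n) ** solution_op A (Suc n) m
      = solution_op A m n ** (matrix_inv (A n) ** A n) ** solution_op A n m"
    using step by (simp add: solution_op_Suc solution_op_Suc_right matrix_mul_assoc)
  then show ?case using step assms(1) by (simp add: matrix_inv_inverse)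
qed simp

lemma solution_op_nonzero:
  assumes "\<And>n. invertible (A n)" and "v \<noteq> 0"
  shows "solution_op A n 0 *v v \<noteq> 0"
proof
  assume "solution_op A n 0 *v v = 0"
  then have "(solution_op A 0 n ** solution_op A n 0) *v v = 0"
    by (simp add: matrix_vector_mul_assoc[symmetric])
  then show False using assms solution_op_inverse[of A 0 n] by simp
qed

lemma invertible_scaled_system:
  assumes "\<gamma> > 0" and "invertible (A n)"
  shows "invertible (scaled_system \<gamma> A n)"
  unfolding scaled_system_def
  using assms by (intro invertible_def[THEN iffD2] exI[of _ "\<gamma> *\<^sub>R matrix_inv (A n)"])
    (simp add: matrix_inv_inverse scalar_matrix_assoc matrix_scalar_ac)

lemma solution_op_scaled:
  "solution_op (scaled_system \<gamma> A) n 0 = (1 / \<gamma>) ^ n *\<^sub>R solution_op A n 0"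
  by (induction n)
    (simp_all add: solution_op_Suc scaled_system_def scalar_matrix_assoc matrix_scalar_ac)

lemma norm_mult_vec_le: "norm (M *v x) \<le> spectral_norm M * norm x"
  unfolding spectral_norm_def by (rule onorm) (rule matrix_vector_mul_bounded_linear)

lemma mrange_idem_iff:
  assumes "M ** M = M"
  shows "x \<in> mrange M \<longleftrightarrow> M *v x = x"
proof
  assume "x \<in> mrange M"
  then obtain y where "x = M *v y" by (auto simp: mrange_def)
  then show "M *v x = x" using assms by (simp add: matrix_vector_mul_assoc)
qed (metis mrange_def rangeI)

lemma compl_idem:
  fixes M :: "real^'d^'d"
  assumes "M ** M = M"
  shows "(mat 1 - M) ** (mat 1 - M) = mat 1 - M"
  using assms
  by (simp add: matrix_eq matrix_vector_mul_assoc[symmetric] matrix_vector_mult_diff_rdistrib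
      matrix_vector_mult_diff_distrib)

section \<open>Domination between sets of trajectories\<close>

text \<open>Division-free form of: between times \<open>m\<close> and \<open>n\<close> the norm
  ratio of the \<open>z\<close>- to the \<open>w\<close>-trajectory shrinks by
  \<open>K * q ^ (n - m)\<close>, uniformly in both times. It is invariant under rescaling the
  system.\<close>

definition dominated :: "(nat \<Rightarrow> real^'d^'d) \<Rightarrow> (real^'d) set \<Rightarrow> (real^'d) set \<Rightarrow> bool" where
  "dominated A Z W \<longleftrightarrow> (\<exists>K q. 0 < K \<and> 0 < q \<and> q < 1 \<and>
     (\<forall>w\<in>W. \<forall>z\<in>Z. \<forall>m n. m \<le> n \<longrightarrow>
        norm (solution_op A n 0 *v z) * norm (solution_op A m 0 *v w)
          \<le> K * q ^ (n - m) * (norm (solution_op A m 0 *v z) * norm (solution_op A n 0 *v w))))"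

lemma dominated_mono: "\<lbrakk>dominated A Z W; W' \<subseteq> W\<rbrakk> \<Longrightarrow> dominated A Z W'"
  unfolding dominated_def by (meson subsetD)

text \<open>Multiply the forward decay of the stable trajectory by the backward decay of the
  unstable one. This gives the rate \<open>\<alpha>s * \<alpha>u\<close> and the constant
  \<open>K^2\<close>, and the powers of \<open>\<gamma>\<close> cancel.\<close>

lemma ED_with_dominated:
  fixes A :: "nat \<Rightarrow> real^'d^'d"
  assumes inv: "\<And>n. invertible (A n)" and \<gamma>: "\<gamma> > 0"
    and ED: "ED_with (solution_op (scaled_system \<gamma> A)) Q"
  shows "dominated A (mrange (Q 0)) (mrange (mat 1 - Q 0))"
proof -
  define \<Psi> where "\<Psi> = solution_op (scaled_system \<gamma> A)"
  have idem: "Q n ** Q n = Q n"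
    and comm: "Q n ** \<Psi> n m = \<Psi> n m ** Q m"
    and comm': "(mat 1 - Q n) ** \<Psi> n m = \<Psi> n m ** (mat 1 - Q m)" for n m
    using ED unfolding ED_with_def \<Psi>_def by blast+
  obtain K \<alpha>s \<alpha>u where c: "0 < K" "0 < \<alpha>s" "\<alpha>s < 1" "0 < \<alpha>u" "\<alpha>u < 1"
    and SU: "\<forall>m n. m \<le> n \<longrightarrow>
      spectral_norm (\<Psi> n m ** Q m) \<le> K * \<alpha>s ^ (n - m) \<and>
      spectral_norm (\<Psi> m n ** (mat 1 - Q n)) \<le> K * \<alpha>u ^ (n - m)"
    using ED unfolding ED_with_def \<Psi>_def[symmetric] by (elim conjE exE) (rule that)
  have norm_scale: "norm (\<Psi> n 0 *v x) = (1 / \<gamma>) ^ n * norm (solution_op A n 0 *v x)" for n x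
    unfolding \<Psi>_def solution_op_scaled scaleR_matrix_vector_assoc[symmetric] norm_scaleR
    using \<gamma> by simp
  have main: "norm (solution_op A n 0 *v z) * norm (solution_op A m 0 *v w)
      \<le> K^2 * (\<alpha>s * \<alpha>u) ^ (n - m) *
          (norm (solution_op A m 0 *v z) * norm (solution_op A n 0 *v w))"
    if w: "w \<in> mrange (mat 1 - Q 0)" and z: "z \<in> mrange (Q 0)" and mn: "m \<le> n" for w z m n
  proof -
    have coc: "\<Psi> n m ** \<Psi> m 0 = \<Psi> n 0"
      unfolding \<Psi>_def by (rule solution_op_cocycle[OF mn])
    have inverse: "\<Psi> m n ** \<Psi> n m = mat 1"
      unfolding \<Psi>_def using inv \<gamma> mn
      by (intro solution_op_inverse invertible_scaled_system)
    have z0: "Q 0 *v z = z" using z idem mrange_idem_iff by blast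
    have w0: "(mat 1 - Q 0) *v w = w" using w compl_idem[OF idem] mrange_idem_iff by blast
    \<comment> \<open>Invariance moves \<open>Q m\<close> back to time 0, where \<open>Q 0\<close>
      fixes \<open>z\<close>.\<close>
    have "(\<Psi> n m ** Q m) *v (\<Psi> m 0 *v z) = (\<Psi> n m ** (Q m ** \<Psi> m 0)) *v z"
      by (simp add: matrix_vector_mul_assoc matrix_mul_assoc)
    also have "\<dots> = \<Psi> n 0 *v z"
      by (metis comm coc z0 matrix_vector_mul_assoc)
    finally have 1: "norm (\<Psi> n 0 *v z) \<le> K * \<alpha>s ^ (n - m) * norm (\<Psi> m 0 *v z)"
      using norm_mult_vec_le[of "\<Psi> n m ** Q m" "\<Psi> m 0 *v z"]
        mult_right_mono[OF SU[rule_format, OF mn, THEN conjunct1], of "norm (\<Psi> m 0 *v z)"] by simp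
    \<comment> \<open>The same for the complementary projector; invertibility then lets
      \<open>\<Psi> m n\<close> carry the trajectory of \<open>w\<close> back from time
      \<open>n\<close> to \<open>m\<close>.\<close>
    have "(\<Psi> m n ** (mat 1 - Q n)) *v (\<Psi> n 0 *v w) = (\<Psi> m n ** ((mat 1 - Q n) ** \<Psi> n 0)) *v w"
      by (simp add: matrix_vector_mul_assoc matrix_mul_assoc)
    also have "\<dots> = (\<Psi> m n ** \<Psi> n 0) *v w"
      by (metis comm' w0 matrix_vector_mul_assoc)
    also have "\<dots> = \<Psi> m 0 *v w"
      by (metis coc inverse matrix_mul_assoc matrix_mul_lid)
    finally have 2: "norm (\<Psi> m 0 *v w) \<le> K * \<alpha>u ^ (n - m) * norm (\<Psi> n 0 *v w)"
      using norm_mult_vec_le[of "\<Psi> m n ** (mat 1 - Q n)" "\<Psi> n 0 *v w"]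
        mult_right_mono[OF SU[rule_format, OF mn, THEN conjunct2], of "norm (\<Psi> n 0 *v w)"] by simp
    \<comment> \<open>Both sides involve one norm at time \<open>n\<close> and one at time
      \<open>m\<close>, so they carry the same scaling factor \<open>g\<close>.\<close>
    define g where "g = (1 / \<gamma>) ^ n * (1 / \<gamma>) ^ m"
    have g: "g > 0" using \<gamma> by (simp add: g_def)
    have "norm (\<Psi> n 0 *v z) * norm (\<Psi> m 0 *v w)
        \<le> (K * \<alpha>s ^ (n - m) * norm (\<Psi> m 0 *v z)) * (K * \<alpha>u ^ (n - m) * norm (\<Psi> n 0 *v w))"
      using 1 2 c by (intro mult_mono) auto
    then have "g * (norm (solution_op A n 0 *v z) * norm (solution_op A m 0 *v w))
      \<le> g * (K^2 * (\<alpha>s * \<alpha>u) ^ (n - m) *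
          (norm (solution_op A m 0 *v z) * norm (solution_op A n 0 *v w)))"
      unfolding norm_scale g_def by (simp add: power_mult_distrib power2_eq_square mult_ac)
    then show ?thesis using g by simp
  qed
  have "0 < K^2" "0 < \<alpha>s * \<alpha>u" "\<alpha>s * \<alpha>u < 1"
    using c mult_strict_mono[of \<alpha>s 1 \<alpha>u 1] by auto
  with main show ?thesis unfolding dominated_def by blast
qed

section \<open>Uniform linear bounds on angle sums\<close>

lemma angle_sum_split:
  "angle_sum A (k + 1) (k + (a + b)) v
     = angle_sum A (k + 1) (k + a) v + angle_sum A (k + a + 1) (k + a + b) v"
  unfolding angle_sum_def add.assoc[symmetric] by (rule sum.ub_add_nat) simp

lemma angle_sum_le: "angle_sum A (k + 1) (k + n) v \<le> real n * (pi / 2)"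
  unfolding angle_sum_def
  using sum_bounded_above[of "{k+1..k+n}" _ "pi/2"] line_angle_le by fastforce

text \<open>The slope \<open>c\<close> is what matters; the constant \<open>C\<close>, uniform in
  \<open>v\<close>, \<open>k\<close> and \<open>n\<close>, absorbs transitions of bounded length.
  The bound is vacuous for the zero subspace.\<close>

definition angle_bound :: "(nat \<Rightarrow> real^'d^'d) \<Rightarrow> (real^'d) set \<Rightarrow> real \<Rightarrow> bool" where
  "angle_bound A V c \<longleftrightarrow>
     (\<exists>C. \<forall>v\<in>V - {0}. \<forall>k n. angle_sum A (k + 1) (k + n) v \<le> real n * c + C)"

section \<open>Merging the bounds of two families\<close>

lemma angle_sum_perturb:
  fixes A :: "nat \<Rightarrow> real^'d^'d"
  assumes inv: "\<And>n. invertible (A n)" and x: "x \<noteq> 0"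
    and d: "\<And>x y a b :: real^'d. \<lbrakk>x \<noteq> 0; y \<noteq> 0; norm a \<le> d * norm x; norm b \<le> d * norm y\<rbrakk>
      \<Longrightarrow> line_angle (x + a) (y + b) \<le> line_angle x y + e"
    and small: "\<And>j. \<lbrakk>k \<le> j; j \<le> k + n; n > 0\<rbrakk> \<Longrightarrow>
      norm (solution_op A j 0 *v a) \<le> d * norm (solution_op A j 0 *v x)"
  shows "angle_sum A (k + 1) (k + n) (x + a) \<le> angle_sum A (k + 1) (k + n) x + real n * e"
proof -
  have "angle_sum A (k + 1) (k + n) (x + a)
      \<le> (\<Sum>j=k+1..k+n. line_angle (solution_op A (j-1) 0 *v x) (solution_op A j 0 *v x) + e)"
    unfolding angle_sum_def matrix_vector_right_distrib
    using inv x by (intro sum_mono d small solution_op_nonzero) auto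
  then show ?thesis by (simp add: angle_sum_def sum.distrib)
qed

text \<open>Domination permits only one switch: once \<open>w\<close> exceeds \<open>d\<close> times
  \<open>z\<close>, after \<open>N\<close> further steps \<open>z\<close> stays below
  \<open>d\<close> times \<open>w\<close>. A window thus splits into a part near \<open>z\<close>,
  at most \<open>N + 1\<close> transition steps, and a part near \<open>w\<close>.\<close>

lemma angle_bound_merge:
  fixes A :: "nat \<Rightarrow> real^'d^'d"
  assumes inv: "\<And>n. invertible (A n)"
    and W: "angle_bound A W c" and Z: "angle_bound A Z c"
    and dom: "dominated A Z W"
    and e: "e > 0"
    and V: "\<And>v. v \<in> V \<Longrightarrow> \<exists>w\<in>W. \<exists>z\<in>Z. v = w + z"
  shows "angle_bound A V (c + e)"
proof -
  obtain C1 where C1: "\<And>v k n. \<lbrakk>v \<in> W; v \<noteq> 0\<rbrakk>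
      \<Longrightarrow> angle_sum A (k + 1) (k + n) v \<le> real n * c + C1"
    using W unfolding angle_bound_def by blast
  obtain C2 where C2: "\<And>v k n. \<lbrakk>v \<in> Z; v \<noteq> 0\<rbrakk>
      \<Longrightarrow> angle_sum A (k + 1) (k + n) v \<le> real n * c + C2"
    using Z unfolding angle_bound_def by blast
  obtain d where d: "d > 0"
    "\<And>x y a b :: real^'d. \<lbrakk>x \<noteq> 0; y \<noteq> 0; norm a \<le> d * norm x; norm b \<le> d * norm y\<rbrakk>
      \<Longrightarrow> line_angle (x + a) (y + b) \<le> line_angle x y + e"
    using line_angle_perturb[OF e] by blast
  obtain K q where Kq: "0 < K" "0 < q" "q < 1"
    and ratio: "\<And>w z m n. \<lbrakk>w \<in> W; z \<in> Z; m \<le> n\<rbrakk> \<Longrightarrow>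
        norm (solution_op A n 0 *v z) * norm (solution_op A m 0 *v w)
          \<le> K * q ^ (n - m) * (norm (solution_op A m 0 *v z) * norm (solution_op A n 0 *v w))"
    using dom unfolding dominated_def by blast
  \<comment> \<open>One factor \<open>d\<close> compensates the threshold
    \<open>x s > d * y s\<close>, the other makes \<open>z\<close> small relative to
    \<open>w\<close>.\<close>
  obtain N where N: "q ^ N < d^2 / K"
    using real_arch_pow_inv[of "d^2 / K" q] Kq d(1) by auto
  \<comment> \<open>The third term bounds the angles of the transition; the last one is needed
    because \<open>c\<close> may be negative.\<close>
  define C where "C = \<bar>C1\<bar> + \<bar>C2\<bar> + real (N + 1) * (pi / 2) + real (N + 1) * \<bar>c\<bar>"
  have "angle_sum A (k + 1) (k + n) v \<le> real n * (c + e) + C" if v: "v \<in> V" "v \<noteq> 0" for v k n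
  proof -
    obtain w z where wz: "w \<in> W" "z \<in> Z" "v = w + z" using V v by blast
    have C: "\<bar>C1\<bar> \<le> C" "\<bar>C2\<bar> \<le> C" by (auto simp: C_def)
    have ne: "0 \<le> real n * e" using e by simp
    consider "w = 0" | "z = 0" | "w \<noteq> 0" "z \<noteq> 0" by blast
    then show ?thesis
    proof cases
      case 1
      then show ?thesis using C2[of z k n] wz v C ne by (simp add: distrib_left)
    next
      case 2
      then show ?thesis using C1[of w k n] wz v C ne by (simp add: distrib_left)
    next
      case 3
      define x y where "x j = norm (solution_op A j 0 *v w)"
        and "y j = norm (solution_op A j 0 *v z)" for j
      have ypos: "y j > 0" for j using solution_op_nonzero[OF inv] 3 by (simp add: y_def)
      have late: "y j \<le> d * x j" if s: "x s > d * y s" and j: "j \<ge> s + N" for s j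
      proof -
        have "y j * (d * y s) \<le> y j * x s" using s ypos[of j] by simp
        also have "\<dots> \<le> K * q ^ (j - s) * (y s * x j)"
          using ratio[of w z s j] wz j by (simp add: x_def y_def)
        also have "\<dots> \<le> d^2 * (y s * x j)"
        proof (intro mult_right_mono)
          have "q ^ (j - s) \<le> q ^ N" using j Kq by (intro power_decreasing) auto
          then have "K * q ^ (j - s) \<le> K * q ^ N" using Kq by simp
          also have "\<dots> \<le> d^2" using N Kq by (simp add: field_simps)
          finally show "K * q ^ (j - s) \<le> d^2" .
        qed (simp add: x_def y_def)
        finally have "(d * y s) * y j \<le> (d * y s) * (d * x j)"
          by (simp add: power2_eq_square mult_ac)
        then show ?thesis using d(1) ypos[of s] by simp
      qed
      show ?thesis
      proof (cases "\<exists>s\<le>k+n. x s > d * y s")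
        \<comment> \<open>The threshold is not crossed up to the end of the window, so
          \<open>v\<close> follows \<open>z\<close> throughout.\<close>
        case False
        then have "angle_sum A (k + 1) (k + n) (z + w) \<le> angle_sum A (k + 1) (k + n) z + real n * e"
          using 3 by (intro angle_sum_perturb[OF inv _ d(2)])
            (auto simp: x_def y_def not_less)
        then show ?thesis using C2[of z k n] wz 3 C by (simp add: distrib_left add.commute)
      next
        case True
        \<comment> \<open>The first crossing is counted from time 0 and may precede the
          window.\<close>
        define s where "s = (LEAST s. x s > d * y s)"
        have s: "x s > d * y s" "s \<le> k + n"
          using True unfolding s_def by (auto intro: LeastI Least_le order_trans)
        have early: "x j \<le> d * y j" if "j < s" for j
          using not_less_Least[OF that[unfolded s_def]] by simp
        \<comment> \<open>The first part ends at time \<open>s - 1\<close>, the last time at which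
          \<open>w\<close> is known to be small; by truncation it is empty if
          \<open>s \<le> k + 1\<close>. Hence \<open>N + 1\<close> steps lead to time
          \<open>s + N\<close>. The minimum cuts the transition off at the end of the
          window.\<close>
        define n1 n2 n3 where "n1 = s - 1 - k" and "n2 = min (n - n1) (N + 1)"
          and "n3 = n - n1 - n2"
        have n: "n = n1 + (n2 + n3)" using s unfolding n1_def n2_def n3_def by linarith
        have "angle_sum A (k + 1) (k + n) v
            = angle_sum A (k + 1) (k + n1) v + angle_sum A (k + n1 + 1) (k + n1 + n2) v
              + angle_sum A (k + n1 + n2 + 1) (k + n1 + n2 + n3) v"
          unfolding n using angle_sum_split[of A k n1 "n2 + n3" v]
            angle_sum_split[of A "k + n1" n2 n3 v] by (simp add: add.assoc)
        moreover have "angle_sum A (k + 1) (k + n1) v \<le> real n1 * c + C2 + real n1 * e"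
        proof -
          have "angle_sum A (k + 1) (k + n1) (z + w)
              \<le> angle_sum A (k + 1) (k + n1) z + real n1 * e"
            using 3 early by (intro angle_sum_perturb[OF inv _ d(2)])
              (auto simp: x_def y_def n1_def)
          then show ?thesis using C2[of z k n1] wz 3 by (simp add: add.commute)
        qed
        moreover have "angle_sum A (k + n1 + 1) (k + n1 + n2) v \<le> real (N + 1) * (pi / 2)"
        proof -
          have "real n2 * (pi / 2) \<le> real (N + 1) * (pi / 2)"
            by (intro mult_right_mono) (auto simp: n2_def)
          then show ?thesis using angle_sum_le[of A "k + n1" n2 v] by linarith
        qed
        moreover have "angle_sum A (k + n1 + n2 + 1) (k + n1 + n2 + n3) v
            \<le> real n3 * c + C1 + real n3 * e"
        proof -
          have "angle_sum A (k + n1 + n2 + 1) (k + n1 + n2 + n3) (w + z)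
              \<le> angle_sum A (k + n1 + n2 + 1) (k + n1 + n2 + n3) w + real n3 * e"
          proof (rule angle_sum_perturb[OF inv _ d(2)])
            fix j assume "k + n1 + n2 \<le> j" "n3 > 0"
            \<comment> \<open>If \<open>n3 > 0\<close>, the minimum is \<open>N + 1\<close>, and
              \<open>k + n1\<close> is at least \<open>s - 1\<close>.\<close>
            then have "s + N \<le> j" unfolding n1_def n2_def n3_def by linarith
            then show "norm (solution_op A j 0 *v z) \<le> d * norm (solution_op A j 0 *v w)"
              using late s(1) by (simp add: x_def y_def)
          qed (use 3 in auto)
          then show ?thesis using C1[of w "k + n1 + n2" n3] wz 3 by simp
        qed
        moreover have "- (real n2 * c) \<le> real (N + 1) * \<bar>c\<bar>"
        proof -
          have "- (real n2 * c) \<le> real n2 * \<bar>c\<bar>"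
            using mult_left_mono[of "-c" "\<bar>c\<bar>" "real n2"] by simp
          also have "\<dots> \<le> real (N + 1) * \<bar>c\<bar>" by (intro mult_right_mono) (auto simp: n2_def)
          finally show ?thesis .
        qed
        moreover have "real n * (c + e)
            = real n1 * c + real n2 * c + real n3 * c + (real n1 * e + real n2 * e + real n3 * e)"
          by (simp add: n algebra_simps)
        moreover have "0 \<le> real n2 * e" using e by simp
        ultimately show ?thesis using abs_ge_self[of C1] abs_ge_self[of C2] unfolding C_def
          by linarith
      qed
    qed
  qed
  then show ?thesis unfolding angle_bound_def by blast
qed

section \<open>Linear bounds and angular values\<close>

text \<open>Windows longer than \<open>N\<close> satisfy the bound without a constant, by the strict
  inequality for the limit. For shorter ones the trivial estimate of \<open>pi / 2\<close> per step
  goes into \<open>C\<close>.\<close>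

lemma angle_bound_of_uniform_limit:
  assumes lim: "(\<lambda>n. ereal (1 / real n) *
      (SUP v\<in>V - {0}. SUP k. ereal (angle_sum A (k+1) (k+n) v))) \<longlonglongrightarrow> L"
    and "L < ereal c"
  shows "angle_bound A V c"
proof -
  have "eventually (\<lambda>n. ereal (1 / real n) *
      (SUP v\<in>V - {0}. SUP k. ereal (angle_sum A (k+1) (k+n) v)) < ereal c) sequentially"
    using order_tendstoD(2)[OF lim assms(2)] .
  then obtain N where N: "\<And>n. n \<ge> N \<Longrightarrow> ereal (1 / real n) *
      (SUP v\<in>V - {0}. SUP k. ereal (angle_sum A (k+1) (k+n) v)) < ereal c"
    by (auto simp: eventually_sequentially)
  define C where "C = real (N + 1) * (pi / 2 + \<bar>c\<bar>)"
  have "angle_sum A (k + 1) (k + n) v \<le> real n * c + C" if v: "v \<in> V - {0}" for v k n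
  \<comment> \<open>\<open>N + 1\<close> instead of \<open>N\<close> ensures \<open>n > 0\<close>
    for the division.\<close>
  proof (cases "n \<ge> N + 1")
    case True
    have "ereal (angle_sum A (k+1) (k+n) v)
        \<le> (SUP v\<in>V - {0}. SUP k. ereal (angle_sum A (k+1) (k+n) v))"
      using v by (intro SUP_upper2[of v] SUP_upper2[of k]) auto
    then have "ereal (1 / real n) * ereal (angle_sum A (k+1) (k+n) v)
        \<le> ereal (1 / real n) * (SUP v\<in>V - {0}. SUP k. ereal (angle_sum A (k+1) (k+n) v))"
      by (intro ereal_mult_left_mono) auto
    also have "\<dots> < ereal c" using N True by simp
    finally have "angle_sum A (k+1) (k+n) v / real n < c" by simp
    then have "angle_sum A (k+1) (k+n) v < real n * c"
      using True by (simp add: field_simps)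
    moreover have "0 \<le> C" by (simp add: C_def)
    ultimately show ?thesis by linarith
  next
    case False
    have "real n * (pi / 2 + \<bar>c\<bar>) \<le> C" unfolding C_def
      using False by (intro mult_right_mono) auto
    moreover have "- (real n * c) \<le> real n * \<bar>c\<bar>"
      using mult_left_mono[of "-c" "\<bar>c\<bar>" "real n"] by simp
    ultimately show ?thesis using angle_sum_le[of A k n v] by (simp add: distrib_left)
  qed
  then show ?thesis unfolding angle_bound_def by blast
qed

text \<open>Take \<open>k = 0\<close>; the slack \<open>b - c\<close> absorbs \<open>C / n\<close>
  as soon as \<open>n > C / (b - c)\<close>.\<close>

lemma inner_angular_value_le:
  assumes "angle_bound A V c" and "c < b"
  shows "inner_angular_value A V \<le> ereal b"
proof -
  obtain C where C: "\<And>v k n. v \<in> V - {0} \<Longrightarrow> angle_sum A (k + 1) (k + n) v \<le> real n * c + C"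
    using assms(1) unfolding angle_bound_def by blast
  have "\<forall>\<^sub>F n in sequentially. real n > 0 \<and> real n > C / (b - c)"
    by (intro eventually_conj eventually_gt_at_top
        filterlim_real_sequentially[unfolded filterlim_at_top_dense, rule_format])
  then have "\<forall>\<^sub>F n in sequentially.
      (SUP v\<in>V - {0}. ereal (angle_sum A 1 n v / real n)) \<le> ereal b"
  proof eventually_elim
    case (elim n)
    have "real n * c + C \<le> b * real n" using elim assms(2) by (simp add: field_simps)
    then have "angle_sum A 1 n v \<le> b * real n" if "v \<in> V - {0}" for v
      using C[OF that, of 0 n] by simp
    then show ?case using elim by (intro SUP_least) (simp add: divide_le_eq)
  qed
  then show ?thesis unfolding inner_angular_value_def by (intro Limsup_bounded)
qed

lemma inner_angular_value_mono:
  "V \<subseteq> W \<Longrightarrow> inner_angular_value A V \<le> inner_angular_value A W"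
  unfolding inner_angular_value_def
  by (intro Limsup_mono always_eventually allI SUP_subset_mono) auto

text \<open>The witness is the midpoint of the gap just below the \<open>i\<close>-th spectral
  interval, with lower end 0 for \<open>i = l\<close>.\<close>

lemma resolvent_interval_nonempty:
  assumes "spectral_intervals A l \<sigma>m \<sigma>p" and "i \<in> {1..l}"
  obtains \<gamma> where "\<gamma> \<in> resolvent_interval l \<sigma>m \<sigma>p (i + 1)" "\<gamma> > 0"
proof -
  have pos: "\<And>j. j \<in> {1..l} \<Longrightarrow> 0 < \<sigma>m j \<and> 0 < \<sigma>p j"
    and gap: "\<And>j. j \<in> {1..<l} \<Longrightarrow> \<sigma>p (j + 1) < \<sigma>m j"
    using assms(1) unfolding spectral_intervals_def by (meson less_le_trans)+
  define a where "a = (if i + 1 = l + 1 then 0 else \<sigma>p (i + 1))"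
  have a: "0 \<le> a" "a < \<sigma>m i"
    using pos[of i] pos[of "i + 1"] gap[of i] assms(2) by (auto simp: a_def)
  show ?thesis
    by (rule that[of "(a + \<sigma>m i) / 2"])
      (use a assms(2) in \<open>auto simp: resolvent_interval_def a_def split: if_splits\<close>)
qed

section \<open>Downward induction along the flag\<close>

theorem theorem3p7:
  fixes A :: "nat \<Rightarrow> real^'d^'d"
    and l :: nat
    and \<sigma>m \<sigma>p :: "nat \<Rightarrow> real"
    and P :: "nat \<Rightarrow> nat \<Rightarrow> real^'d^'d"
  assumes "\<And>n. invertible (A n)"
    and "bdd_above (range (\<lambda>n. spectral_norm (A n)))"
    and "bdd_above (range (\<lambda>n. spectral_norm (matrix_inv (A n))))"
    and "spectral_intervals A l \<sigma>m \<sigma>p"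
    and "dichotomy_projectors A l \<sigma>m \<sigma>p P"
    and "\<And>i. i \<in> {1..l} \<Longrightarrow>
      (\<lambda>n. ereal (1 / real n) *
          (SUP v\<in>spectral_fiber P 0 i - {0}. SUP k. ereal (angle_sum A (k+1) (k+n) v)))
        \<longlonglongrightarrow> inner_angular_value A (spectral_fiber P 0 i)"
  shows "inner_angular_value A UNIV =
    (MAX i\<in>{1..l}. inner_angular_value A (spectral_fiber P 0 i))"
proof (rule antisym)
  define M where "M = (MAX i\<in>{1..l}. inner_angular_value A (spectral_fiber P 0 i))"
  have l: "1 \<le> l" using assms(4) by (simp add: spectral_intervals_def)
  have ED: "\<exists>\<gamma>>0. ED_with (solution_op (scaled_system \<gamma> A)) (\<lambda>n. P n (i + 1))"
    if i: "i \<in> {1..l}" for i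
  proof -
    obtain \<gamma> where "\<gamma> \<in> resolvent_interval l \<sigma>m \<sigma>p (i + 1)" "\<gamma> > 0"
      using resolvent_interval_nonempty[OF assms(4) i] .
    then show ?thesis using assms(5) i unfolding dichotomy_projectors_def by force
  qed
  have end0: "mrange (P 0 (l + 1)) = {0}" and start: "mrange (P 0 1) = UNIV"
    and flag: "\<And>i. i \<in> {1..l} \<Longrightarrow> mrange (P 0 (i + 1)) \<subseteq> mrange (P 0 i)"
    using assms(5) unfolding dichotomy_projectors_def by blast+
  have idem: "P 0 (i + 1) ** P 0 (i + 1) = P 0 (i + 1)" if "i \<in> {1..l}" for i
    using ED[OF that] unfolding ED_with_def by blast
  have mrange_diff: "x - y \<in> mrange B" if "x \<in> mrange B" "y \<in> mrange B"
    for x y and B :: "real^'d^'d"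
  proof -
    obtain a b where "x = B *v a" "y = B *v b" using \<open>x \<in> mrange B\<close> \<open>y \<in> mrange B\<close>
      by (auto simp: mrange_def)
    then have "x - y = B *v (a - b)" by (simp add: matrix_vector_mult_diff_distrib)
    then show ?thesis by (auto simp: mrange_def)
  qed
  have "angle_bound A (mrange (P 0 i)) c" if "1 \<le> i" "i \<le> l + 1" "M < ereal c" for i c
    using that(2,1,3)
  \<comment> \<open>The induction starts at the trivial range for \<open>l + 1\<close>. The slope
    \<open>c\<close> stays arbitrary because every merge costs a little of it.\<close>
  proof (induction i arbitrary: c rule: inc_induct)
    case base
    then show ?case unfolding angle_bound_def using end0 by simp
  next
    case (step i)
    then have i: "i \<in> {1..l}" by simp
    obtain c' where c': "M < ereal c'" "c' < c"
      using ereal_dense2[OF step.prems(2)] by auto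
    have Mi: "inner_angular_value A (spectral_fiber P 0 i) \<le> M"
      unfolding M_def using i by (intro Max_ge) auto
    have W: "angle_bound A (spectral_fiber P 0 i) c'"
      using Mi c'(1) by (intro angle_bound_of_uniform_limit[OF assms(6)[OF i]]) auto
    have Z: "angle_bound A (mrange (P 0 (i + 1))) c'"
      using step.IH[OF _ c'(1)] by simp
    obtain \<gamma> where \<gamma>: "\<gamma> > 0"
      "ED_with (solution_op (scaled_system \<gamma> A)) (\<lambda>n. P n (i + 1))"
      using ED[OF i] by blast
    from ED_with_dominated[OF assms(1) \<gamma>]
    have dom: "dominated A (mrange (P 0 (i + 1))) (spectral_fiber P 0 i)"
      by (rule dominated_mono) (simp add: spectral_fiber_def)
    \<comment> \<open>Split \<open>v\<close> by the projector with index \<open>i + 1\<close>. The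
      flag puts \<open>z\<close> into the range of \<open>P 0 i\<close>, so \<open>v - z\<close>
      stays there too and lies in the fiber.\<close>
    have "\<exists>w\<in>spectral_fiber P 0 i. \<exists>z\<in>mrange (P 0 (i + 1)). v = w + z"
      if v: "v \<in> mrange (P 0 i)" for v
    proof -
      define z where "z = P 0 (i + 1) *v v"
      have z: "z \<in> mrange (P 0 (i + 1))" by (simp add: z_def mrange_def)
      have "v - z \<in> mrange (P 0 i)" using mrange_diff v z flag[OF i] by blast
      moreover have "v - z = (mat 1 - P 0 (i + 1)) *v v"
        by (simp add: z_def matrix_vector_mult_diff_rdistrib)
      ultimately have "v - z \<in> spectral_fiber P 0 i"
        by (auto simp: spectral_fiber_def mrange_def)
      moreover have "v = (v - z) + z" by simp
      ultimately show ?thesis using z by blast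
    qed
    \<comment> \<open>The loss \<open>e\<close> of the merge is chosen as
      \<open>c - c'\<close>.\<close>
    then have "angle_bound A (mrange (P 0 i)) (c' + (c - c'))"
      using c'(2) by (intro angle_bound_merge[OF assms(1) W Z dom]) auto
    then show ?case by simp
  qed
  then have bound: "angle_bound A UNIV c" if "M < ereal c" for c
    using start that l by (metis le_add2 order_refl)
  show "inner_angular_value A UNIV \<le> M"
  \<comment> \<open>Two real numbers \<open>c < b\<close> between \<open>M\<close> and
    \<open>y\<close> leave room to absorb the additive constant.\<close>
  proof (rule dense_ge)
    fix y assume "M < y"
    then obtain c where c: "M < ereal c" "ereal c < y" using ereal_dense2 by blast
    then obtain b where b: "ereal c < ereal b" "ereal b < y" using ereal_dense2 by blast
    have "inner_angular_value A UNIV \<le> ereal b"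
      using inner_angular_value_le[OF bound[OF c(1)]] b(1) by simp
    then show "inner_angular_value A UNIV \<le> y" using b(2) by order
  qed
  show "M \<le> inner_angular_value A UNIV"
    unfolding M_def using l by (auto intro!: Max.boundedI inner_angular_value_mono)
qed

end
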